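(* Let $R$ be a finite commutative ring with identity such that $\Gamma(R)$ is a complete graph, and let $F$ be a finite field with $|F|\geq 3$. Then $$\gamma^o(\Gamma(F \times R)) = |Z(R)^*| + \min \left\{ |U(R)|,\ |F^*|,\ 2 + \left\lfloor \frac{|U(R)|-|Z(R)^*|}{2} \right\rfloor + \left\lfloor \frac{|F^*|}{2} \right\rfloor \right\}.$$
   Context: $Z(R)^*$ denotes the set of nonzero zero-divisors of $R$, $U(R)$ the set of units of $R$, and $F^*=F\setminus\{0\}$. The zero-divisor graph $\Gamma(R)$ is the simple graph with vertex set $Z(R)^*$, in which distinct $u,v$ are adjacent if and only if $uv=0$. For a simple graph $\Gamma=(V,E)$, a set $S\subseteq V$ and a vertex $v$, let $\delta_S(v)$ be the number of neighbors of $v$ in $S$ and $\overline{S}=V\setminus S$. A nonempty set $S\subseteq V$ is a global offensive alliance if $\delta_S(v)\geq \delta_{\overline{S}}(v)+1$ for every $v\in\overline{S}$. $\gamma^o(\Gamma)$ is the minimum cardinality of a global offensive alliance of $\Gamma$. *)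

theory Defs
  imports Complex_Main "HOL-Algebra.Ring" "HOL-Algebra.Chinese_Remainder"
begin

(* A simple graph is a pair (V, E), where E consists of two-element subsets of V. *)

type_synonym 'a sgraph = "'a set \<times> 'a set set"

definition complete_sgraph :: "'a sgraph \<Rightarrow> bool" where
  "complete_sgraph G \<longleftrightarrow> (\<forall>u\<in>fst G. \<forall>v\<in>fst G. u \<noteq> v \<longrightarrow> {u, v} \<in> snd G)"

definition nbrs_in :: "'a sgraph \<Rightarrow> 'a set \<Rightarrow> 'a \<Rightarrow> nat" where
  "nbrs_in G S v = card {u \<in> S. {u, v} \<in> snd G}"

definition global_offensive_alliance :: "'a sgraph \<Rightarrow> 'a set \<Rightarrow> bool" where
  "global_offensive_alliance G S \<longleftrightarrow>
     S \<noteq> {} \<and> S \<subseteq> fst G \<and>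
     (\<forall>v \<in> fst G - S. nbrs_in G S v \<ge> nbrs_in G (fst G - S) v + 1)"

(* Intended for finite nonempty graphs, where the whole vertex set is a global offensive
   alliance, so that the minimum exists. *)

definition global_offensive_alliance_number :: "'a sgraph \<Rightarrow> nat" where
  "global_offensive_alliance_number G =
     (LEAST k. \<exists>S. global_offensive_alliance G S \<and> card S = k)"

definition nonzero_zero_divisors :: "('a, 'm) ring_scheme \<Rightarrow> 'a set" where
  "nonzero_zero_divisors R =
     {x \<in> carrier R. x \<noteq> \<zero>\<^bsub>R\<^esub> \<and> (\<exists>y \<in> carrier R. y \<noteq> \<zero>\<^bsub>R\<^esub> \<and> x \<otimes>\<^bsub>R\<^esub> y = \<zero>\<^bsub>R\<^esub>)}"

definition zero_divisor_graph :: "('a, 'm) ring_scheme \<Rightarrow> 'a sgraph" where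
  "zero_divisor_graph R =
     (nonzero_zero_divisors R,
      {{u, v} | u v. u \<in> nonzero_zero_divisors R \<and> v \<in> nonzero_zero_divisors R \<and>
                     u \<noteq> v \<and> u \<otimes>\<^bsub>R\<^esub> v = \<zero>\<^bsub>R\<^esub>})"

end

theory Submission
  imports Defs "HOL-Algebra.Multiplicative_Group" "HOL-Library.Disjoint_Sets"
begin

text \<open>
  If the zero-divisor graph of \<open>R\<close> is complete, then either all products of zero-divisors vanish, or
  some zero-divisor is an idempotent \<open>e\<close> and \<open>R = {0, 1, e, 1 - e}\<close>. In the first case the vertices
  \<open>(a, r)\<close> of the graph of \<open>F \<times> R\<close> fall into four parts, with \<open>A\<close>: \<open>r = 0\<close>; \<open>B\<close>: \<open>a = 0\<close>, \<open>r\<close> a unit;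
  \<open>C\<close>: \<open>a = 0\<close>, \<open>r\<close> a zero-divisor; \<open>D\<close>: \<open>a \<noteq> 0\<close>, \<open>r\<close> a zero-divisor. Neighbourhoods are annihilators,
  hence constant on each part up to removing the vertex itself: \<open>B \<union> C\<close> on \<open>A\<close>, \<open>A\<close> on \<open>B\<close>, \<open>A \<union> C \<union> D\<close>
  on \<open>C\<close> and \<open>C\<close> on \<open>D\<close>. A global offensive alliance contains a majority of the neighbours of every
  vertex outside it, so either it contains \<open>B\<close>, or it contains \<open>A\<close>, or it contains majorities of both
  \<open>A\<close> and \<open>B \<union> C\<close>; in each case the optimum contains \<open>C\<close> and avoids \<open>D\<close>. In the second case
  \<open>{0} \<times> (R - {0})\<close> is an alliance of 3 vertices, and 3 is optimal because three closed neighbourhoods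
  are pairwise disjoint.
\<close>

section \<open>Global offensive alliances\<close>

definition nbrs :: "'a sgraph \<Rightarrow> 'a \<Rightarrow> 'a set" where
  "nbrs G v = {u \<in> fst G. {u, v} \<in> snd G}"

definition closed_nbrs :: "'a sgraph \<Rightarrow> 'a \<Rightarrow> 'a set" where
  "closed_nbrs G v = insert v (nbrs G v)"

lemma nbrs_in_eq_card: "S \<subseteq> fst G \<Longrightarrow> nbrs_in G S v = card (S \<inter> nbrs G v)"
  unfolding nbrs_in_def nbrs_def by (rule arg_cong[where f = card]) blast

lemma global_offensive_alliance_iff_majority:
  assumes "finite (fst G)"
  shows "global_offensive_alliance G S \<longleftrightarrow> S \<noteq> {} \<and> S \<subseteq> fst G \<and>
    (\<forall>v\<in>fst G - S. card (nbrs G v) < 2 * card (S \<inter> nbrs G v))"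
proof -
  have "nbrs_in G (fst G - S) v + 1 \<le> nbrs_in G S v \<longleftrightarrow>
      card (nbrs G v) < 2 * card (S \<inter> nbrs G v)" if S: "S \<subseteq> fst G" for v
  proof -
    have "(fst G - S) \<inter> nbrs G v = nbrs G v - S"
      by (auto simp: nbrs_def)
    moreover have "card (nbrs G v) = card (S \<inter> nbrs G v) + card (nbrs G v - S)"
      using card_Int_Diff[of "nbrs G v" S] assms by (simp add: nbrs_def Int_commute)
    ultimately show ?thesis
      using S by (simp add: nbrs_in_eq_card) linarith
  qed
  then show ?thesis
    unfolding global_offensive_alliance_def by blast
qed

lemma global_offensive_alliance_dominating:
  assumes "finite (fst G)" "global_offensive_alliance G S" "v \<in> fst G"
  shows "S \<inter> closed_nbrs G v \<noteq> {}"
proof (cases "v \<in> S")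
  case False
  then have "card (nbrs G v) < 2 * card (S \<inter> nbrs G v)"
    using assms by (simp add: global_offensive_alliance_iff_majority)
  then have "S \<inter> nbrs G v \<noteq> {}"
    by auto
  then show ?thesis
    by (auto simp: closed_nbrs_def)
qed (auto simp: closed_nbrs_def)

lemma card_packing_le_global_offensive_alliance:
  assumes "finite (fst G)" "global_offensive_alliance G S"
    and "P \<subseteq> fst G" "disjoint_family_on (closed_nbrs G) P"
  shows "card P \<le> card S"
proof -
  have "\<forall>v\<in>P. \<exists>u. u \<in> S \<inter> closed_nbrs G v"
    using global_offensive_alliance_dominating[OF assms(1,2)] assms(3) by blast
  then obtain s where s: "\<And>v. v \<in> P \<Longrightarrow> s v \<in> S \<inter> closed_nbrs G v"
    by metis
  have "inj_on s P"
  proof (rule inj_onI, rule ccontr)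
    fix v w assume "v \<in> P" "w \<in> P" "s v = s w" "v \<noteq> w"
    then show False
      using s[of v] s[of w] disjoint_family_onD[OF assms(4), of v w] by auto
  qed
  moreover have "finite S"
    using assms(1,2) by (auto simp: global_offensive_alliance_def intro: finite_subset)
  ultimately show ?thesis
    using s by (intro card_inj_on_le[of s]) auto
qed

lemma vertex_cover_global_offensive_alliance:
  assumes "finite (fst G)" "S \<noteq> {}" "S \<subseteq> fst G"
    and "\<And>v. v \<in> fst G - S \<Longrightarrow> nbrs G v \<noteq> {} \<and> nbrs G v \<subseteq> S"
  shows "global_offensive_alliance G S"
proof -
  have "card (nbrs G v) < 2 * card (S \<inter> nbrs G v)" if "v \<in> fst G - S" for v
  proof -
    have "finite (nbrs G v)"
      using assms(1) by (simp add: nbrs_def)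
    then show ?thesis
      using assms(4)[OF that] by (simp add: Int_absorb1 card_gt_0_iff)
  qed
  then show ?thesis
    using assms(1-3) by (simp add: global_offensive_alliance_iff_majority)
qed

lemma global_offensive_alliance_numberI:
  assumes "global_offensive_alliance G S" "card S = k"
    and "\<And>T. global_offensive_alliance G T \<Longrightarrow> k \<le> card T"
  shows "global_offensive_alliance_number G = k"
  unfolding global_offensive_alliance_number_def
  using assms by (intro Least_equality) auto

section \<open>Graphs with four parts\<close>

lemma card_Int_Un_disjoint:
  assumes "finite P" "finite Q" "P \<inter> Q = {}"
  shows "card (S \<inter> (P \<union> Q)) = card (S \<inter> P) + card (S \<inter> Q)"
proof -
  have "(S \<inter> P) \<inter> (S \<inter> Q) = {}"
    using assms(3) by blast
  then show ?thesis
    using assms(1,2) by (simp add: Int_Un_distrib card_Un_disjoint)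
qed

text \<open>The last term adds the sizes of least majorities of \<open>a\<close> vertices and of \<open>b + c\<close> vertices.\<close>

definition four_part_alliance_number :: "nat \<Rightarrow> nat \<Rightarrow> nat \<Rightarrow> nat" where
  "four_part_alliance_number a b c =
    min (b + c) (min (a + c) (a div 2 + (b + c) div 2 + 2))"

locale four_part_graph =
  fixes G :: "'a sgraph" and A B C D :: "'a set"
  assumes vertices: "fst G = A \<union> B \<union> C \<union> D"
    and finite_parts: "finite A" "finite B" "finite C" "finite D"
    and disjoint_parts: "A \<inter> B = {}" "A \<inter> C = {}" "A \<inter> D = {}" "B \<inter> C = {}" "B \<inter> D = {}" "C \<inter> D = {}"
    and nbrs_A: "\<And>v. v \<in> A \<Longrightarrow> nbrs G v = B \<union> C"
    and nbrs_B: "\<And>v. v \<in> B \<Longrightarrow> nbrs G v = A"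
    and nbrs_C: "\<And>v. v \<in> C \<Longrightarrow> nbrs G v = A \<union> C \<union> D - {v}"
    and nbrs_D: "\<And>v. v \<in> D \<Longrightarrow> nbrs G v = C"
begin

lemma finite_vertices: "finite (fst G)"
  using finite_parts by (simp add: vertices)

lemma card_Int_parts:
  "card (S \<inter> (B \<union> C)) = card (S \<inter> B) + card (S \<inter> C)"
  "card (S \<inter> (A \<union> C \<union> D)) = card (S \<inter> A) + card (S \<inter> C) + card (S \<inter> D)"
  "card (S \<inter> fst G) = card (S \<inter> A) + card (S \<inter> B) + card (S \<inter> C) + card (S \<inter> D)"
  by (simp_all add: vertices card_Int_Un_disjoint finite_parts disjoint_parts Int_Un_distrib2)

lemma majority_nbrs_C_iff:
  assumes "v \<in> C" "v \<notin> S"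
  shows "card (nbrs G v) < 2 * card (S \<inter> nbrs G v) \<longleftrightarrow>
    card A + card C + card D \<le> 2 * (card (S \<inter> A) + card (S \<inter> C) + card (S \<inter> D))"
proof -
  have "card (nbrs G v) + 1 = card (A \<union> C \<union> D)"
    using assms(1) card_Suc_Diff1[of "A \<union> C \<union> D" v] finite_parts by (simp add: nbrs_C)
  moreover have "S \<inter> nbrs G v = S \<inter> (A \<union> C \<union> D)"
    using assms by (auto simp: nbrs_C)
  ultimately show ?thesis
    using card_Int_parts(2)[of S] card_Int_parts(2)[of UNIV] by (simp add: less_eq_Suc_le)
qed

lemma global_offensive_alliance_iff:
  "global_offensive_alliance G S \<longleftrightarrow> S \<noteq> {} \<and> S \<subseteq> fst G \<and>
    (A \<subseteq> S \<or> card B + card C < 2 * (card (S \<inter> B) + card (S \<inter> C))) \<and>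
    (B \<subseteq> S \<or> card A < 2 * card (S \<inter> A)) \<and>
    (C \<subseteq> S \<or> card A + card C + card D \<le> 2 * (card (S \<inter> A) + card (S \<inter> C) + card (S \<inter> D))) \<and>
    (D \<subseteq> S \<or> card C < 2 * card (S \<inter> C))"
proof -
  let ?majority = "\<lambda>v. card (nbrs G v) < 2 * card (S \<inter> nbrs G v)"
  have "(\<forall>v\<in>fst G - S. ?majority v) \<longleftrightarrow>
      (\<forall>v\<in>A - S. ?majority v) \<and> (\<forall>v\<in>B - S. ?majority v) \<and>
      (\<forall>v\<in>C - S. ?majority v) \<and> (\<forall>v\<in>D - S. ?majority v)"
    unfolding vertices by blast
  also have "(\<forall>v\<in>A - S. ?majority v) \<longleftrightarrow>
      A \<subseteq> S \<or> card B + card C < 2 * (card (S \<inter> B) + card (S \<inter> C))"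
    using card_Int_parts(1)[of S] card_Int_parts(1)[of UNIV] by (auto simp: nbrs_A)
  also have "(\<forall>v\<in>B - S. ?majority v) \<longleftrightarrow> B \<subseteq> S \<or> card A < 2 * card (S \<inter> A)"
    by (auto simp: nbrs_B)
  also have "(\<forall>v\<in>C - S. ?majority v) \<longleftrightarrow>
      C \<subseteq> S \<or> card A + card C + card D \<le> 2 * (card (S \<inter> A) + card (S \<inter> C) + card (S \<inter> D))"
    by (auto simp: majority_nbrs_C_iff)
  also have "(\<forall>v\<in>D - S. ?majority v) \<longleftrightarrow> D \<subseteq> S \<or> card C < 2 * card (S \<inter> C)"
    by (auto simp: nbrs_D)
  finally show ?thesis
    using global_offensive_alliance_iff_majority[OF finite_vertices] by simp
qed

lemma global_offensive_alliance_card_ge: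
  assumes S: "global_offensive_alliance G S"
    and "A \<noteq> {}" "C \<noteq> {} \<Longrightarrow> card A + card C \<le> card D + 1"
  shows "four_part_alliance_number (card A) (card B) (card C) \<le> card S"
proof -
  have card_S: "card S = card (S \<inter> A) + card (S \<inter> B) + card (S \<inter> C) + card (S \<inter> D)"
    using S card_Int_parts(3)[of S] by (simp add: global_offensive_alliance_def Int_absorb2)
  have "card A > 0"
    using assms(2) finite_parts by (simp add: card_gt_0_iff)
  have cases_C: "S \<inter> C = C \<or> card A + card C \<le> card D + 1 \<and>
      card A + card C + card D \<le> 2 * (card (S \<inter> A) + card (S \<inter> C) + card (S \<inter> D))"
    using S assms(3) by (auto simp: global_offensive_alliance_iff)
  have "card (S \<inter> A) \<le> card A"
    using finite_parts by (simp add: card_mono)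
  consider (contains_B) "B \<subseteq> S" | (contains_A) "A \<subseteq> S"
    | (majorities) "card B + card C < 2 * (card (S \<inter> B) + card (S \<inter> C))" "card A < 2 * card (S \<inter> A)"
    using S by (auto simp: global_offensive_alliance_iff)
  then show ?thesis
  proof cases
    case contains_B
    have "card C \<le> card (S \<inter> A) + card (S \<inter> C) + card (S \<inter> D)"
      using cases_C \<open>card A > 0\<close> by (elim disjE) auto
    then show ?thesis
      using card_S contains_B by (simp add: four_part_alliance_number_def Int_absorb1)
  next
    case contains_A
    have "card C \<le> card (S \<inter> C) + card (S \<inter> D)"
      using cases_C \<open>card (S \<inter> A) \<le> card A\<close> by (elim disjE) auto
    then show ?thesis
      using card_S contains_A by (simp add: four_part_alliance_number_def Int_absorb1)
  next
    case majorities
    then have "card A div 2 < card (S \<inter> A)"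
        "(card B + card C) div 2 < card (S \<inter> B) + card (S \<inter> C)"
      by (simp_all only: less_mult_imp_div_less mult.commute[of 2])
    then show ?thesis
      using card_S by (simp add: four_part_alliance_number_def)
  qed
qed

lemma global_offensive_alliance_Un_C:
  assumes "X \<subseteq> A" "Y \<subseteq> B" "X \<union> Y \<noteq> {}" "C = {} \<Longrightarrow> D = {}"
    and "X = A \<or> card B < 2 * card Y + card C" "Y = B \<or> card A < 2 * card X"
  shows "global_offensive_alliance G (X \<union> Y \<union> C)"
    and "card (X \<union> Y \<union> C) = card X + card Y + card C"
proof -
  have Int_parts: "(X \<union> Y \<union> C) \<inter> A = X" "(X \<union> Y \<union> C) \<inter> B = Y" "(X \<union> Y \<union> C) \<inter> C = C"
    "(X \<union> Y \<union> C) \<inter> D = {}"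
    using assms(1,2) disjoint_parts by blast+
  have vertices_XYC: "X \<union> Y \<union> C \<subseteq> fst G"
    using assms(1,2) vertices by blast
  then show "card (X \<union> Y \<union> C) = card X + card Y + card C"
    using card_Int_parts(3)[of "X \<union> Y \<union> C"] by (simp add: Int_parts Int_absorb2)
  have "D \<subseteq> X \<union> Y \<union> C \<or> card C < 2 * card C"
    using assms(4) finite_parts by (auto simp: card_gt_0_iff)
  then show "global_offensive_alliance G (X \<union> Y \<union> C)"
    unfolding global_offensive_alliance_iff Int_parts using assms(3,5,6) vertices_XYC by auto
qed

lemma global_offensive_alliance_exists:
  assumes "A \<noteq> {}" "B \<noteq> {}" "C = {} \<Longrightarrow> D = {}" "card C \<le> card B"
  obtains S where "global_offensive_alliance G S"
    and "card S = four_part_alliance_number (card A) (card B) (card C)"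
proof -
  let ?m = "card A div 2 + 1" and ?n = "(card B + card C) div 2 + 1 - card C"
  let ?k = "four_part_alliance_number (card A) (card B) (card C)"
  have "card A div 2 + (card B + card C) div 2 + 2 = ?m + ?n + card C"
    using assms(4) by linarith
  then consider (contain_B) "?k = card B + card C" | (contain_A) "?k = card A + card C"
    | (majorities) "?k = ?m + ?n + card C" "?m \<le> card A" "?n \<le> card B"
    unfolding four_part_alliance_number_def by linarith
  then show thesis
  proof cases
    case contain_B
    then show thesis
      using global_offensive_alliance_Un_C[of "{}" B] assms that[of "B \<union> C"]
      by (auto simp: card_gt_0_iff finite_parts)
  next
    case contain_A
    then show thesis
      using global_offensive_alliance_Un_C[of A "{}"] assms that[of "A \<union> C"]
      by (auto simp: card_gt_0_iff finite_parts)
  next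
    case majorities
    then obtain X Y where "X \<subseteq> A" "card X = ?m" "Y \<subseteq> B" "card Y = ?n"
      using obtain_subset_with_card_n by metis
    moreover from this have "X \<noteq> {}" "card A < 2 * card X" "card B < 2 * card Y + card C"
      by (auto; linarith)+
    ultimately show thesis
      using global_offensive_alliance_Un_C[of X Y] assms(3) that[of "X \<union> Y \<union> C"] majorities(1)
      by auto
  qed
qed

lemma global_offensive_alliance_number_eq:
  assumes "A \<noteq> {}" "B \<noteq> {}" "C = {} \<Longrightarrow> D = {}" "card C \<le> card B"
    and "C \<noteq> {} \<Longrightarrow> card A + card C \<le> card D + 1"
  shows "global_offensive_alliance_number G =
    four_part_alliance_number (card A) (card B) (card C)"
  using global_offensive_alliance_exists[OF assms(1-4)]
    global_offensive_alliance_card_ge[OF _ assms(1,5)]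
  by (metis global_offensive_alliance_numberI)

end

section \<open>Annihilators and zero-divisors\<close>

definition zero_divisor_products_vanish :: "('a, 'm) ring_scheme \<Rightarrow> bool" where
  "zero_divisor_products_vanish R \<longleftrightarrow>
    (\<forall>x\<in>nonzero_zero_divisors R. \<forall>y\<in>nonzero_zero_divisors R. x \<otimes>\<^bsub>R\<^esub> y = \<zero>\<^bsub>R\<^esub>)"

definition annihilator :: "('a, 'm) ring_scheme \<Rightarrow> 'a \<Rightarrow> 'a set" where
  "annihilator R x = {y \<in> carrier R. y \<otimes>\<^bsub>R\<^esub> x = \<zero>\<^bsub>R\<^esub>}"

lemma fst_zero_divisor_graph [simp]: "fst (zero_divisor_graph R) = nonzero_zero_divisors R"
  by (simp add: zero_divisor_graph_def)

lemma (in domain) annihilator_domain: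
  "x \<in> carrier R \<Longrightarrow> annihilator R x = (if x = \<zero> then carrier R else {\<zero>})"
  by (auto simp: annihilator_def integral_iff)

context cring
begin

lemma nonzero_zero_divisors_eq_annihilator:
  "nonzero_zero_divisors R = {x \<in> carrier R - {\<zero>}. annihilator R x \<noteq> {\<zero>}}"
  unfolding nonzero_zero_divisors_def annihilator_def using m_comm by fastforce

lemma nonzero_zero_divisors_closed: "x \<in> nonzero_zero_divisors R \<Longrightarrow> x \<in> carrier R"
  by (simp add: nonzero_zero_divisors_def)

lemma annihilator_zero: "annihilator R \<zero> = carrier R"
  by (auto simp: annihilator_def)

lemma annihilator_zero_divisor:
  assumes "zero_divisor_products_vanish R" "z \<in> nonzero_zero_divisors R"
  shows "annihilator R z = insert \<zero> (nonzero_zero_divisors R)"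
proof
  show "annihilator R z \<subseteq> insert \<zero> (nonzero_zero_divisors R)"
    using assms(2) by (auto simp: annihilator_def nonzero_zero_divisors_def)
  show "insert \<zero> (nonzero_zero_divisors R) \<subseteq> annihilator R z"
    using assms nonzero_zero_divisors_closed
    by (simp add: annihilator_def zero_divisor_products_vanish_def subset_iff)
qed

lemma annihilator_Units:
  assumes "u \<in> Units R"
  shows "annihilator R u = {\<zero>}"
proof -
  have "y = \<zero>" if "y \<in> carrier R" "y \<otimes> u = \<zero>" for y
    using assms that by (metis Units_closed Units_l_cancel m_comm r_null zero_closed)
  then show ?thesis
    using assms by (auto simp: annihilator_def)
qed

lemma Units_Int_nonzero_zero_divisors: "Units R \<inter> nonzero_zero_divisors R = {}"
  by (auto simp: nonzero_zero_divisors_eq_annihilator annihilator_Units)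

lemma zero_notin_Units: "\<one> \<noteq> \<zero> \<Longrightarrow> \<zero> \<notin> Units R"
  using annihilator_Units[of \<zero>] annihilator_zero by auto

lemma annihilator_trivial_imp_Units:
  assumes "finite (carrier R)" "x \<in> carrier R" "annihilator R x = {\<zero>}"
  shows "x \<in> Units R"
proof -
  have "inj_on (\<lambda>y. y \<otimes> x) (carrier R)"
  proof (rule inj_onI)
    fix y z assume yz: "y \<in> carrier R" "z \<in> carrier R" "y \<otimes> x = z \<otimes> x"
    then have "(y \<ominus> z) \<otimes> x = \<zero>"
      using assms(2) by (simp add: minus_eq l_distr l_minus r_neg)
    then have "y \<ominus> z \<in> annihilator R x"
      using yz by (simp add: annihilator_def)
    then show "y = z"
      using yz assms(3) by simp
  qed
  then have "(\<lambda>y. y \<otimes> x) ` carrier R = carrier R"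
    using assms(1,2) by (intro endo_inj_surj) auto
  then obtain y where "y \<in> carrier R" "y \<otimes> x = \<one>"
    by (metis imageE one_closed)
  then show ?thesis
    using assms(2) m_comm[of y x] unfolding Units_def by auto
qed

lemma finite_carrier_minus_zero:
  assumes "finite (carrier R)" "\<one> \<noteq> \<zero>"
  shows "carrier R - {\<zero>} = Units R \<union> nonzero_zero_divisors R"
  using annihilator_trivial_imp_Units[OF assms(1)] zero_notin_Units[OF assms(2)]
  by (auto simp: nonzero_zero_divisors_eq_annihilator)

lemma nonzero_zero_divisors_mult:
  assumes "x \<in> nonzero_zero_divisors R" "r \<in> carrier R" "r \<otimes> x \<noteq> \<zero>"
  shows "r \<otimes> x \<in> nonzero_zero_divisors R"
proof -
  obtain y where "x \<in> carrier R" "y \<in> carrier R" "y \<noteq> \<zero>" "x \<otimes> y = \<zero>"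
    using assms(1) unfolding nonzero_zero_divisors_def by blast
  moreover from this have "(r \<otimes> x) \<otimes> y = \<zero>"
    using assms(2) by (simp add: m_assoc)
  ultimately show ?thesis
    using assms(2,3) unfolding nonzero_zero_divisors_def by blast
qed

lemma edge_zero_divisor_graph_iff:
  "{u, v} \<in> snd (zero_divisor_graph R) \<longleftrightarrow>
     u \<in> nonzero_zero_divisors R \<and> v \<in> nonzero_zero_divisors R \<and> u \<noteq> v \<and> u \<otimes> v = \<zero>"
proof -
  have "u \<otimes> v = v \<otimes> u" if "u \<in> nonzero_zero_divisors R" "v \<in> nonzero_zero_divisors R"
    using that nonzero_zero_divisors_closed by (simp add: m_comm)
  then show ?thesis
    unfolding zero_divisor_graph_def by (auto simp: doubleton_eq_iff)
qed

lemma nbrs_zero_divisor_graph: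
  assumes "v \<in> nonzero_zero_divisors R"
  shows "nbrs (zero_divisor_graph R) v = annihilator R v - {\<zero>, v}"
proof -
  have "v \<in> carrier R" "v \<noteq> \<zero>"
    using assms by (simp_all add: nonzero_zero_divisors_def)
  then show ?thesis
    using assms
    by (auto simp: nbrs_def edge_zero_divisor_graph_iff annihilator_def nonzero_zero_divisors_def)
qed

lemma one_plus_square_zero_Units:
  assumes "x \<in> carrier R" "x \<otimes> x = \<zero>"
  shows "\<one> \<oplus> x \<in> Units R"
proof -
  have "(\<one> \<oplus> x) \<otimes> (\<one> \<ominus> x) = \<one> \<ominus> x \<otimes> x"
    using assms(1) by algebra
  then have "(\<one> \<oplus> x) \<otimes> (\<one> \<ominus> x) = \<one>"
    using assms(2) by (simp add: minus_eq)
  then show ?thesis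
    using assms(1) m_comm[of "\<one> \<oplus> x" "\<one> \<ominus> x"] unfolding Units_def by auto
qed

lemma card_zero_divisors_le_card_Units:
  assumes "finite (Units R)" "\<forall>x\<in>nonzero_zero_divisors R. x \<otimes> x = \<zero>"
  shows "card (nonzero_zero_divisors R) \<le> card (Units R)"
proof (rule card_inj_on_le[where f = "\<lambda>x. \<one> \<oplus> x"])
  show "inj_on (\<lambda>x. \<one> \<oplus> x) (nonzero_zero_divisors R)"
    by (rule inj_onI) (simp add: nonzero_zero_divisors_def)
  show "(\<lambda>x. \<one> \<oplus> x) ` nonzero_zero_divisors R \<subseteq> Units R"
    using assms(2) nonzero_zero_divisors_closed one_plus_square_zero_Units by blast
qed (fact assms(1))

lemma idempotent_complement:
  assumes "e \<in> carrier R" "e \<otimes> e = e"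
  shows "e \<oplus> (\<one> \<ominus> e) = \<one>" "e \<otimes> (\<one> \<ominus> e) = \<zero>" "(\<one> \<ominus> e) \<otimes> e = \<zero>"
    "(\<one> \<ominus> e) \<otimes> (\<one> \<ominus> e) = \<one> \<ominus> e"
proof -
  show "e \<oplus> (\<one> \<ominus> e) = \<one>"
    using assms(1) by algebra
  have "e \<otimes> (\<one> \<ominus> e) = e \<ominus> e \<otimes> e"
    using assms(1) by algebra
  then show orthogonal: "e \<otimes> (\<one> \<ominus> e) = \<zero>"
    using assms by simp
  then show "(\<one> \<ominus> e) \<otimes> e = \<zero>"
    using assms(1) m_comm[of e "\<one> \<ominus> e"] by simp
  have "(\<one> \<ominus> e) \<otimes> (\<one> \<ominus> e) = \<one> \<ominus> e \<ominus> e \<otimes> (\<one> \<ominus> e)"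
    using assms(1) by algebra
  then show "(\<one> \<ominus> e) \<otimes> (\<one> \<ominus> e) = \<one> \<ominus> e"
    using assms(1) orthogonal by (simp add: minus_eq)
qed

end

locale four_element_boolean_ring = cring +
  fixes e
  assumes idempotent: "e \<in> carrier R" "e \<otimes> e = e" "e \<noteq> \<zero>" "e \<noteq> \<one>"
    and carrier_eq: "carrier R = {\<zero>, \<one>, e, \<one> \<ominus> e}"
begin

lemmas complement = idempotent_complement[OF idempotent(1,2)]

lemma distinct_elements: "distinct [\<zero>, \<one>, e, \<one> \<ominus> e]"
proof -
  have "\<one> \<noteq> \<zero>"
    using idempotent(1,3) l_null l_one by metis
  moreover have "\<one> \<ominus> e \<noteq> \<one>" "\<one> \<ominus> e \<noteq> e"
    using idempotent complement by auto
  moreover have "\<zero> \<noteq> \<one> \<ominus> e"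
    using idempotent(1,4) r_right_minus_eq one_closed by metis
  ultimately show ?thesis
    using idempotent by auto
qed

lemma annihilator_idempotents:
  "annihilator R e = {\<zero>, \<one> \<ominus> e}" "annihilator R (\<one> \<ominus> e) = {\<zero>, e}"
proof -
  have "\<zero> \<otimes> x = \<zero>" "\<one> \<otimes> x = x" if "x \<in> {e, \<one> \<ominus> e}" for x
    using that idempotent(1) by auto
  then show "annihilator R e = {\<zero>, \<one> \<ominus> e}" "annihilator R (\<one> \<ominus> e) = {\<zero>, e}"
    using distinct_elements idempotent complement by (auto simp: annihilator_def carrier_eq)
qed

lemma nonzero_zero_divisors_eq: "nonzero_zero_divisors R = {e, \<one> \<ominus> e}"
  using distinct_elements annihilator_idempotents annihilator_Units[OF Units_one_closed]
  unfolding nonzero_zero_divisors_eq_annihilator carrier_eq by auto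

lemma Units_eq: "Units R = {\<one>}"
proof -
  have "Units R \<subseteq> {\<zero>, \<one>, e, \<one> \<ominus> e}"
    using Units_closed carrier_eq by blast
  moreover have "\<zero> \<notin> Units R" "e \<notin> Units R" "\<one> \<ominus> e \<notin> Units R"
    using distinct_elements zero_notin_Units Units_Int_nonzero_zero_divisors
    by (auto simp: nonzero_zero_divisors_eq)
  ultimately show ?thesis
    using Units_one_closed by blast
qed

end

locale complete_zero_divisor_cring = cring +
  assumes complete: "complete_sgraph (zero_divisor_graph R)"
begin

lemma mult_distinct_zero_divisors:
  "u \<in> nonzero_zero_divisors R \<Longrightarrow> v \<in> nonzero_zero_divisors R \<Longrightarrow> u \<noteq> v \<Longrightarrow> u \<otimes> v = \<zero>"
  using complete unfolding complete_sgraph_def by (simp add: edge_zero_divisor_graph_iff)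

lemma zero_divisor_square_cases:
  assumes e: "e \<in> nonzero_zero_divisors R"
  shows "e \<otimes> e = \<zero> \<or> e \<otimes> e = e"
proof (rule ccontr)
  assume square: "\<not> (e \<otimes> e = \<zero> \<or> e \<otimes> e = e)"
  have [simp]: "e \<in> carrier R"
    using e by (rule nonzero_zero_divisors_closed)
  have "e \<otimes> (e \<otimes> e) = \<zero>"
    using square e by (metis mult_distinct_zero_divisors nonzero_zero_divisors_mult \<open>e \<in> carrier R\<close>)
  then have mult_sum: "e \<otimes> (e \<oplus> e \<otimes> e) = e \<otimes> e"
    by (simp add: r_distr)
  have "(\<one> \<oplus> e) \<otimes> e = e \<oplus> e \<otimes> e"
    by (simp add: l_distr)
  moreover have "e \<oplus> e \<otimes> e \<noteq> \<zero>"
    using mult_sum square by auto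
  ultimately have "e \<oplus> e \<otimes> e \<in> nonzero_zero_divisors R"
    using nonzero_zero_divisors_mult[OF e, of "\<one> \<oplus> e"] by simp
  moreover have "e \<oplus> e \<otimes> e \<noteq> e"
    using square by simp
  ultimately show False
    using mult_distinct_zero_divisors[OF e] mult_sum square by metis
qed

lemma mult_idempotent_zero_divisor_cases:
  assumes "e \<in> nonzero_zero_divisors R" "e \<otimes> e = e" "x \<in> carrier R"
  shows "x \<otimes> e = \<zero> \<or> x \<otimes> e = e"
proof (rule ccontr)
  assume product: "\<not> (x \<otimes> e = \<zero> \<or> x \<otimes> e = e)"
  have "(x \<otimes> e) \<otimes> e = \<zero>"
    using product assms by (intro mult_distinct_zero_divisors nonzero_zero_divisors_mult) auto
  then show False
    using product assms nonzero_zero_divisors_closed by (simp add: m_assoc)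
qed

lemma four_element_boolean_ring:
  assumes e: "e \<in> nonzero_zero_divisors R" "e \<otimes> e \<noteq> \<zero>"
  shows "four_element_boolean_ring R e"
proof -
  have idempotent: "e \<in> carrier R" "e \<otimes> e = e" "e \<noteq> \<zero>" "e \<noteq> \<one>"
    using e zero_divisor_square_cases[OF e(1)] Units_Int_nonzero_zero_divisors
    by (auto simp: nonzero_zero_divisors_def)
  note complement = idempotent_complement[OF idempotent(1,2)]
  have "\<one> \<ominus> e \<in> nonzero_zero_divisors R"
    using idempotent complement by (auto simp: nonzero_zero_divisors_def)
  have "x \<in> {\<zero>, \<one>, e, \<one> \<ominus> e}" if x: "x \<in> carrier R" for x
  proof -
    have "x = x \<otimes> e \<oplus> x \<otimes> (\<one> \<ominus> e)"
      using x idempotent(1) by algebra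
    moreover have "x \<otimes> e = \<zero> \<or> x \<otimes> e = e"
      using e(1) idempotent(2) x by (rule mult_idempotent_zero_divisor_cases)
    moreover have "x \<otimes> (\<one> \<ominus> e) = \<zero> \<or> x \<otimes> (\<one> \<ominus> e) = \<one> \<ominus> e"
      using \<open>\<one> \<ominus> e \<in> nonzero_zero_divisors R\<close> complement(4) x
      by (rule mult_idempotent_zero_divisor_cases)
    ultimately show ?thesis
      using idempotent(1) complement(1) by auto
  qed
  then show ?thesis
    using idempotent by unfold_locales auto
qed

end

section \<open>The product of a domain and a ring\<close>

lemma mult_RDirProd: "x \<otimes>\<^bsub>RDirProd R S\<^esub> y = (fst x \<otimes>\<^bsub>R\<^esub> fst y, snd x \<otimes>\<^bsub>S\<^esub> snd y)"
  by (simp add: RDirProd_def monoid.defs DirProd_def case_prod_beta)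

lemma zero_RDirProd: "\<zero>\<^bsub>RDirProd R S\<^esub> = (\<zero>\<^bsub>R\<^esub>, \<zero>\<^bsub>S\<^esub>)"
  by (simp add: RDirProd_def monoid.defs)

lemma cring_RDirProd:
  assumes "cring R" "cring S"
  shows "cring (RDirProd R S)"
proof -
  interpret R: cring R by fact
  interpret S: cring S by fact
  interpret ring "RDirProd R S"
    using RDirProd_ring R.ring_axioms S.ring_axioms .
  show ?thesis
    by unfold_locales (auto simp: mult_RDirProd RDirProd_carrier R.m_comm S.m_comm)
qed

lemma annihilator_RDirProd:
  "annihilator (RDirProd R S) (x, y) = annihilator R x \<times> annihilator S y"
  by (auto simp: annihilator_def RDirProd_carrier mult_RDirProd zero_RDirProd)

locale domain_cring_prod = F: domain F + R: cring R
  for F :: "('a, 'm) ring_scheme" and R :: "('b, 'n) ring_scheme" +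
  assumes R_nontrivial: "\<one>\<^bsub>R\<^esub> \<noteq> \<zero>\<^bsub>R\<^esub>"
begin

sublocale prod: cring "RDirProd F R"
  using F.is_cring R.is_cring by (rule cring_RDirProd)

abbreviation prod_graph :: "('a \<times> 'b) sgraph" where
  "prod_graph \<equiv> zero_divisor_graph (RDirProd F R)"

lemma nonzero_zero_divisors_prod:
  "nonzero_zero_divisors (RDirProd F R) =
    {\<zero>\<^bsub>F\<^esub>} \<times> (carrier R - {\<zero>\<^bsub>R\<^esub>}) \<union>
    (carrier F - {\<zero>\<^bsub>F\<^esub>}) \<times> insert \<zero>\<^bsub>R\<^esub> (nonzero_zero_divisors R)"
proof -
  have annihilator_zero_nontrivial: "annihilator R \<zero>\<^bsub>R\<^esub> \<noteq> {\<zero>\<^bsub>R\<^esub>}"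
    using R.annihilator_zero R.one_closed R_nontrivial by blast
  have "(a, r) \<in> nonzero_zero_divisors (RDirProd F R) \<longleftrightarrow>
      (a, r) \<noteq> (\<zero>\<^bsub>F\<^esub>, \<zero>\<^bsub>R\<^esub>) \<and>
      (a = \<zero>\<^bsub>F\<^esub> \<or> r = \<zero>\<^bsub>R\<^esub> \<or> r \<in> nonzero_zero_divisors R)"
    if ar: "a \<in> carrier F" "r \<in> carrier R" for a r
  proof -
    have "annihilator (RDirProd F R) (a, r) = {(\<zero>\<^bsub>F\<^esub>, \<zero>\<^bsub>R\<^esub>)} \<longleftrightarrow>
        annihilator F a = {\<zero>\<^bsub>F\<^esub>} \<and> annihilator R r = {\<zero>\<^bsub>R\<^esub>}"
      using times_eq_iff[of "annihilator F a" "annihilator R r" "{\<zero>\<^bsub>F\<^esub>}" "{\<zero>\<^bsub>R\<^esub>}"]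
      by (simp add: annihilator_RDirProd)
    also have "annihilator F a = {\<zero>\<^bsub>F\<^esub>} \<longleftrightarrow> a \<noteq> \<zero>\<^bsub>F\<^esub>"
      using ar(1) F.one_closed F.one_not_zero F.annihilator_domain by (metis singletonD)
    also have "annihilator R r = {\<zero>\<^bsub>R\<^esub>} \<longleftrightarrow> r \<noteq> \<zero>\<^bsub>R\<^esub> \<and> r \<notin> nonzero_zero_divisors R"
      using ar(2) annihilator_zero_nontrivial by (auto simp: R.nonzero_zero_divisors_eq_annihilator)
    finally show ?thesis
      using ar by (auto simp: prod.nonzero_zero_divisors_eq_annihilator RDirProd_carrier zero_RDirProd)
  qed
  moreover have "nonzero_zero_divisors (RDirProd F R) \<subseteq> carrier F \<times> carrier R"
    using prod.nonzero_zero_divisors_closed RDirProd_carrier by blast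
  moreover have "nonzero_zero_divisors R \<subseteq> carrier R"
    using R.nonzero_zero_divisors_closed by blast
  ultimately show ?thesis
    by blast
qed

lemma nbrs_prod_zero:
  assumes "r \<in> carrier R - {\<zero>\<^bsub>R\<^esub>}"
  shows "nbrs prod_graph (\<zero>\<^bsub>F\<^esub>, r) =
    carrier F \<times> annihilator R r - {(\<zero>\<^bsub>F\<^esub>, \<zero>\<^bsub>R\<^esub>), (\<zero>\<^bsub>F\<^esub>, r)}"
  using assms
  by (subst prod.nbrs_zero_divisor_graph)
    (simp_all add: nonzero_zero_divisors_prod annihilator_RDirProd zero_RDirProd F.annihilator_zero)

lemma nbrs_prod_nonzero:
  assumes "a \<in> carrier F - {\<zero>\<^bsub>F\<^esub>}" "r \<in> insert \<zero>\<^bsub>R\<^esub> (nonzero_zero_divisors R)"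
  shows "nbrs prod_graph (a, r) = {\<zero>\<^bsub>F\<^esub>} \<times> (annihilator R r - {\<zero>\<^bsub>R\<^esub>})"
proof -
  have "(a, r) \<in> nonzero_zero_divisors (RDirProd F R)"
    using assms nonzero_zero_divisors_prod by blast
  moreover have "annihilator F a = {\<zero>\<^bsub>F\<^esub>}"
    using assms(1) by (simp add: F.annihilator_domain)
  ultimately show ?thesis
    using assms(1) by (auto simp: prod.nbrs_zero_divisor_graph annihilator_RDirProd zero_RDirProd)
qed

lemma nbrs_prod_nonzero_zero:
  assumes "a \<in> carrier F - {\<zero>\<^bsub>F\<^esub>}"
  shows "nbrs prod_graph (a, \<zero>\<^bsub>R\<^esub>) = {\<zero>\<^bsub>F\<^esub>} \<times> (carrier R - {\<zero>\<^bsub>R\<^esub>})"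
  using assms by (simp add: nbrs_prod_nonzero R.annihilator_zero)

lemma nbrs_prod_nonzero_zero_divisor:
  assumes "zero_divisor_products_vanish R"
    and "a \<in> carrier F - {\<zero>\<^bsub>F\<^esub>}" "z \<in> nonzero_zero_divisors R"
  shows "nbrs prod_graph (a, z) = {\<zero>\<^bsub>F\<^esub>} \<times> nonzero_zero_divisors R"
proof -
  have "annihilator R z - {\<zero>\<^bsub>R\<^esub>} = nonzero_zero_divisors R"
    unfolding R.annihilator_zero_divisor[OF assms(1,3)] by (auto simp: nonzero_zero_divisors_def)
  then show ?thesis
    using assms(2,3) by (simp add: nbrs_prod_nonzero)
qed

lemma nbrs_prod_Units:
  assumes "u \<in> Units R"
  shows "nbrs prod_graph (\<zero>\<^bsub>F\<^esub>, u) = (carrier F - {\<zero>\<^bsub>F\<^esub>}) \<times> {\<zero>\<^bsub>R\<^esub>}"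
proof -
  have "u \<in> carrier R - {\<zero>\<^bsub>R\<^esub>}"
    using assms R.zero_notin_Units[OF R_nontrivial] by auto
  then have "nbrs prod_graph (\<zero>\<^bsub>F\<^esub>, u) =
      carrier F \<times> {\<zero>\<^bsub>R\<^esub>} - {(\<zero>\<^bsub>F\<^esub>, \<zero>\<^bsub>R\<^esub>), (\<zero>\<^bsub>F\<^esub>, u)}"
    using assms by (simp only: nbrs_prod_zero R.annihilator_Units)
  then show ?thesis
    using \<open>u \<in> carrier R - {\<zero>\<^bsub>R\<^esub>}\<close> by auto
qed

lemma nbrs_prod_zero_divisor:
  assumes "zero_divisor_products_vanish R" "z \<in> nonzero_zero_divisors R"
  shows "nbrs prod_graph (\<zero>\<^bsub>F\<^esub>, z) =
    carrier F \<times> insert \<zero>\<^bsub>R\<^esub> (nonzero_zero_divisors R) - {(\<zero>\<^bsub>F\<^esub>, \<zero>\<^bsub>R\<^esub>), (\<zero>\<^bsub>F\<^esub>, z)}"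
proof -
  have "z \<in> carrier R - {\<zero>\<^bsub>R\<^esub>}"
    using assms(2) by (simp add: nonzero_zero_divisors_def)
  then show ?thesis
    by (simp only: nbrs_prod_zero R.annihilator_zero_divisor[OF assms])
qed

end

locale finite_domain_cring_prod = domain_cring_prod +
  assumes finite_F: "finite (carrier F)" and finite_R: "finite (carrier R)"
begin

lemma card_nonzero_F_pos: "card (carrier F - {\<zero>\<^bsub>F\<^esub>}) > 0"
proof -
  have "\<one>\<^bsub>F\<^esub> \<in> carrier F - {\<zero>\<^bsub>F\<^esub>}"
    by simp
  then show ?thesis
    using finite_F by (metis card_gt_0_iff empty_iff finite_Diff)
qed

lemma finite_vertices: "finite (fst prod_graph)"
proof (rule finite_subset)
  show "fst prod_graph \<subseteq> carrier F \<times> carrier R"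
    using prod.nonzero_zero_divisors_closed by (auto simp: RDirProd_carrier)
qed (use finite_F finite_R in blast)

lemma global_offensive_alliance_zero_times:
  "global_offensive_alliance prod_graph ({\<zero>\<^bsub>F\<^esub>} \<times> (carrier R - {\<zero>\<^bsub>R\<^esub>}))"
proof (rule vertex_cover_global_offensive_alliance)
  show "{\<zero>\<^bsub>F\<^esub>} \<times> (carrier R - {\<zero>\<^bsub>R\<^esub>}) \<noteq> {}"
    using R_nontrivial R.one_closed by blast
next
  fix v assume "v \<in> fst prod_graph - {\<zero>\<^bsub>F\<^esub>} \<times> (carrier R - {\<zero>\<^bsub>R\<^esub>})"
  then obtain a r where v: "v = (a, r)" "a \<in> carrier F - {\<zero>\<^bsub>F\<^esub>}"
      "r \<in> insert \<zero>\<^bsub>R\<^esub> (nonzero_zero_divisors R)"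
    by (auto simp: nonzero_zero_divisors_prod)
  have "annihilator R r - {\<zero>\<^bsub>R\<^esub>} \<noteq> {}"
    using v(3) R_nontrivial R.one_closed
    by (auto simp: R.annihilator_zero annihilator_def nonzero_zero_divisors_def R.m_comm)
  then show "nbrs prod_graph v \<noteq> {} \<and> nbrs prod_graph v \<subseteq> {\<zero>\<^bsub>F\<^esub>} \<times> (carrier R - {\<zero>\<^bsub>R\<^esub>})"
    using nbrs_prod_nonzero[OF v(2,3)] v(1) by (auto simp: annihilator_def)
qed (use finite_vertices nonzero_zero_divisors_prod in auto)

lemma global_offensive_alliance_number_boolean:
  assumes "four_element_boolean_ring R e"
  shows "global_offensive_alliance_number prod_graph = 3"
proof (rule global_offensive_alliance_numberI)
  interpret R: four_element_boolean_ring R e by fact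
  let ?f = "\<one>\<^bsub>R\<^esub> \<ominus>\<^bsub>R\<^esub> e"
  show "global_offensive_alliance prod_graph ({\<zero>\<^bsub>F\<^esub>} \<times> (carrier R - {\<zero>\<^bsub>R\<^esub>}))"
    by (rule global_offensive_alliance_zero_times)
  show "card ({\<zero>\<^bsub>F\<^esub>} \<times> (carrier R - {\<zero>\<^bsub>R\<^esub>})) = 3"
    using R.distinct_elements by (auto simp: card_cartesian_product_singleton R.carrier_eq)
  fix S assume "global_offensive_alliance prod_graph S"
  let ?P = "{(\<zero>\<^bsub>F\<^esub>, \<one>\<^bsub>R\<^esub>), (\<one>\<^bsub>F\<^esub>, e), (\<one>\<^bsub>F\<^esub>, ?f)}"
  have "?P \<subseteq> fst prod_graph"
    using R_nontrivial by (simp add: nonzero_zero_divisors_prod R.nonzero_zero_divisors_eq)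
  have "closed_nbrs prod_graph (\<zero>\<^bsub>F\<^esub>, \<one>\<^bsub>R\<^esub>) \<subseteq> UNIV \<times> {\<zero>\<^bsub>R\<^esub>, \<one>\<^bsub>R\<^esub>}"
    using R_nontrivial by (auto simp: closed_nbrs_def nbrs_prod_zero R.annihilator_Units)
  moreover have "closed_nbrs prod_graph (\<one>\<^bsub>F\<^esub>, e) \<subseteq> {(\<one>\<^bsub>F\<^esub>, e), (\<zero>\<^bsub>F\<^esub>, ?f)}"
    by (auto simp: closed_nbrs_def nbrs_prod_nonzero R.nonzero_zero_divisors_eq
        R.annihilator_idempotents)
  moreover have "closed_nbrs prod_graph (\<one>\<^bsub>F\<^esub>, ?f) \<subseteq> {(\<one>\<^bsub>F\<^esub>, ?f), (\<zero>\<^bsub>F\<^esub>, e)}"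
    by (auto simp: closed_nbrs_def nbrs_prod_nonzero R.nonzero_zero_divisors_eq
        R.annihilator_idempotents)
  ultimately have "disjoint_family_on (closed_nbrs prod_graph) ?P"
    using R.distinct_elements unfolding disjoint_family_on_def by fastforce
  then have "card ?P \<le> card S"
    using \<open>?P \<subseteq> fst prod_graph\<close> \<open>global_offensive_alliance prod_graph S\<close> finite_vertices
    by (intro card_packing_le_global_offensive_alliance)
  then show "3 \<le> card S"
    using R.distinct_elements by simp
qed

lemma four_part_prod_graph:
  assumes "zero_divisor_products_vanish R"
  shows "four_part_graph prod_graph
    ((carrier F - {\<zero>\<^bsub>F\<^esub>}) \<times> {\<zero>\<^bsub>R\<^esub>}) ({\<zero>\<^bsub>F\<^esub>} \<times> Units R)
    ({\<zero>\<^bsub>F\<^esub>} \<times> nonzero_zero_divisors R) ((carrier F - {\<zero>\<^bsub>F\<^esub>}) \<times> nonzero_zero_divisors R)"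
    (is "four_part_graph _ ?A ?B ?C ?D")
proof
  note carrier_R = R.finite_carrier_minus_zero[OF finite_R R_nontrivial]
  have zero_notin: "\<zero>\<^bsub>R\<^esub> \<notin> Units R" "\<zero>\<^bsub>R\<^esub> \<notin> nonzero_zero_divisors R"
    using carrier_R by blast+
  have "fst prod_graph = {\<zero>\<^bsub>F\<^esub>} \<times> (Units R \<union> nonzero_zero_divisors R) \<union>
      (carrier F - {\<zero>\<^bsub>F\<^esub>}) \<times> insert \<zero>\<^bsub>R\<^esub> (nonzero_zero_divisors R)"
    by (simp only: fst_zero_divisor_graph nonzero_zero_divisors_prod carrier_R)
  then show "fst prod_graph = ?A \<union> ?B \<union> ?C \<union> ?D"
    by auto
  have "finite (Units R \<union> nonzero_zero_divisors R)"
    using finite_R carrier_R finite_Diff by metis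
  then show "finite ?A" "finite ?B" "finite ?C" "finite ?D"
    using finite_F by simp_all
  show "?A \<inter> ?B = {}" "?A \<inter> ?C = {}" "?A \<inter> ?D = {}" "?B \<inter> ?C = {}" "?B \<inter> ?D = {}" "?C \<inter> ?D = {}"
    using zero_notin R.Units_Int_nonzero_zero_divisors by blast+
  show "nbrs prod_graph v = ?B \<union> ?C" if "v \<in> ?A" for v
    using that
    by (elim SigmaE) (simp only: singleton_iff nbrs_prod_nonzero_zero carrier_R Sigma_Un_distrib2)
  show "nbrs prod_graph v = ?A" if "v \<in> ?B" for v
    using that nbrs_prod_Units by blast
  show "nbrs prod_graph v = ?A \<union> ?C \<union> ?D - {v}" if "v \<in> ?C" for v
    using that zero_notin(2) by (auto simp: nbrs_prod_zero_divisor[OF assms])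
  show "nbrs prod_graph v = ?C" if "v \<in> ?D" for v
    using that by (elim SigmaE) (simp only: nbrs_prod_nonzero_zero_divisor[OF assms])
qed

lemma global_offensive_alliance_number_products_vanish:
  assumes "zero_divisor_products_vanish R"
  shows "global_offensive_alliance_number prod_graph =
    four_part_alliance_number (card (carrier F - {\<zero>\<^bsub>F\<^esub>})) (card (Units R))
      (card (nonzero_zero_divisors R))"
proof -
  let ?Z = "nonzero_zero_divisors R"
  let ?A = "(carrier F - {\<zero>\<^bsub>F\<^esub>}) \<times> {\<zero>\<^bsub>R\<^esub>}" and ?B = "{\<zero>\<^bsub>F\<^esub>} \<times> Units R"
    and ?C = "{\<zero>\<^bsub>F\<^esub>} \<times> ?Z" and ?D = "(carrier F - {\<zero>\<^bsub>F\<^esub>}) \<times> ?Z"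
  interpret four_part_graph prod_graph ?A ?B ?C ?D
    using assms by (rule four_part_prod_graph)
  have card_parts: "card ?A = card (carrier F - {\<zero>\<^bsub>F\<^esub>})" "card ?B = card (Units R)"
    "card ?C = card ?Z" "card ?D = card ?A * card ?C"
    by (simp_all add: card_cartesian_product del: card_Diff_insert)
  have "card ?A > 0"
    using card_nonzero_F_pos card_parts(1) by simp
  then have "?A \<noteq> {}"
    by fastforce
  moreover have "?B \<noteq> {}"
    by blast
  moreover have "card ?C \<le> card ?B"
    unfolding card_parts using assms finite_R
    by (intro R.card_zero_divisors_le_card_Units) (auto simp: zero_divisor_products_vanish_def)
  moreover have "card ?A + card ?C \<le> card ?D + 1" if "?C \<noteq> {}"
  proof -
    have "card ?C > 0"
      using that finite_parts(3) card_gt_0_iff by blast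
    then obtain m n where "card ?A = Suc m" "card ?C = Suc n"
      using \<open>card ?A > 0\<close> gr0_conv_Suc by metis
    then show ?thesis
      by (simp add: card_parts(4))
  qed
  ultimately show ?thesis
    using global_offensive_alliance_number_eq card_parts by auto
qed

lemma global_offensive_alliance_number_complete:
  assumes "complete_sgraph (zero_divisor_graph R)"
  shows "global_offensive_alliance_number prod_graph =
    four_part_alliance_number (card (carrier F - {\<zero>\<^bsub>F\<^esub>})) (card (Units R))
      (card (nonzero_zero_divisors R))"
proof -
  interpret R: complete_zero_divisor_cring R
    by unfold_locales fact
  show ?thesis
  proof (cases "\<forall>x\<in>nonzero_zero_divisors R. x \<otimes>\<^bsub>R\<^esub> x = \<zero>\<^bsub>R\<^esub>")
    case True
    then have "zero_divisor_products_vanish R"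
      unfolding zero_divisor_products_vanish_def using R.mult_distinct_zero_divisors by metis
    then show ?thesis
      by (rule global_offensive_alliance_number_products_vanish)
  next
    case False
    then obtain e where boolean: "four_element_boolean_ring R e"
      using R.four_element_boolean_ring by blast
    then interpret boolean: four_element_boolean_ring R e .
    have "card (Units R) = 1" "card (nonzero_zero_divisors R) = 2"
      using boolean.distinct_elements
      by (simp_all add: boolean.Units_eq boolean.nonzero_zero_divisors_eq)
    then show ?thesis
      using global_offensive_alliance_number_boolean[OF boolean] card_nonzero_F_pos
      by (simp add: four_part_alliance_number_def del: card_Diff_insert)
  qed
qed

end

lemma four_part_alliance_number_eq_add_Min_floor:
  "int (four_part_alliance_number f u z) =
    int z + Min {int u, int f, 2 + \<lfloor>(real u - real z) / 2\<rfloor> + \<lfloor>real f / 2\<rfloor>}"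
proof -
  have "\<lfloor>(real u - real z) / 2\<rfloor> = (int u - int z) div 2"
    using floor_divide_of_int_eq[of "int u - int z" 2, where ?'a = real] by simp
  moreover have "\<lfloor>real f / 2\<rfloor> = int (f div 2)"
    using floor_divide_of_nat_eq[of f 2, where ?'a = real] by simp
  moreover have "int z + (int u - int z) div 2 = int ((u + z) div 2)"
    by linarith
  ultimately have "int z + (2 + \<lfloor>(real u - real z) / 2\<rfloor> + \<lfloor>real f / 2\<rfloor>) =
      int (f div 2 + (u + z) div 2 + 2)"
    by simp
  moreover have "int z + int u = int (u + z)" "int z + int f = int (f + z)"
    by simp_all
  moreover have "k + Min {x, y, w} = min (k + x) (min (k + y) (k + w))" for k x y w :: int
    by (simp add: min_add_distrib_right)
  ultimately show ?thesis
    by (simp only: four_part_alliance_number_def of_nat_min)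
qed

theorem theorem2p10:
  fixes R :: "('a, 'm) ring_scheme" and F :: "('b, 'n) ring_scheme"
  assumes "cring R" and "\<one>\<^bsub>R\<^esub> \<noteq> \<zero>\<^bsub>R\<^esub>" and "finite (carrier R)"
    and "complete_sgraph (zero_divisor_graph R)"
    and "field F" and "finite (carrier F)" and "card (carrier F) \<ge> 3"
  shows "int (global_offensive_alliance_number (zero_divisor_graph (RDirProd F R))) =
    int (card (nonzero_zero_divisors R)) +
    Min {int (card (Units R)),
         int (card (carrier F - {\<zero>\<^bsub>F\<^esub>})),
         2 + \<lfloor>(real (card (Units R)) - real (card (nonzero_zero_divisors R))) / 2\<rfloor>
           + \<lfloor>real (card (carrier F - {\<zero>\<^bsub>F\<^esub>})) / 2\<rfloor>}"
proof -
  interpret F: field F by fact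
  interpret R: cring R by fact
  interpret finite_domain_cring_prod F R
    using assms(2,3,6) by unfold_locales
  show ?thesis
    unfolding global_offensive_alliance_number_complete[OF assms(4)]
    by (rule four_part_alliance_number_eq_add_Min_floor)
qed

end
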